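(* Let $(Q_k)_{k\ge0}$ be the Q-learning iterates and let $(Q_k^L)_{k\ge0}$ be the lower comparison system, i.e. the stochastic linear system $$Q_{k+1}^L-Q^*=A_{Q^*}(Q_k^L-Q^* )+\alpha w_k,\qquad Q_0^L-Q^*\in\mathbb R^{|\mathcal S||\mathcal A|},$$ driven by the same noise $w_k$ as the Q-learning iteration (all objects defined in the context). Suppose $Q_0^L-Q^*\le Q_0-Q^*$, where $\le$ is element-wise. Then $Q_k^L-Q^*\le Q_k-Q^*$ (element-wise) for all $k\ge0$.
   Context: MDP: finite state space $\mathcal S=\{1,\dots,|\mathcal S|\}$, finite action space $\mathcal A=\{1,\dots,|\mathcal A|\}$, transition probabilities $P(s'|s,a)$, deterministic reward function $r(s,a,s')$, discount factor $\gamma\in[0,1)$. The MDP is assumed ergodic. $Q^*$ is the optimal Q-function (satisfying $Q^*(s,a)=\sum_{s'}P(s'|s,a)(r(s,a,s')+\gamma\max_{u}Q^*(s',u))$). Sampling: $p$ is a distribution on $\mathcal S$, $\beta(\cdot|s)$ a behavior policy, $d(s,a)=p(s)\beta(a|s)$. At each step $k$, independently of the past, $s_k\sim p$, $a_k\sim\beta(\cdot|s_k)$, $s_k'\sim P(\cdot|s_k,a_k)$, $r_k=r(s_k,a_k,s_k')$. Vector notation: functions on $\mathcal S\times\mathcal A$ are vectors in $\mathbb R^{|\mathcal S||\mathcal A|}$, stacked as $Q=(Q(\cdot,1);\dots;Q(\cdot,|\mathcal A|))$, so $Q(s,a)=(e_a\otimes e_s)^TQ$ with standard basis vectors $e_a\in\mathbb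 R^{|\mathcal A|}$, $e_s\in\mathbb R^{|\mathcal S|}$. $P\in\mathbb R^{|\mathcal S||\mathcal A|\times|\mathcal S|}$ is the matrix with entry $P(s'|s,a)$ in row $(s,a)$ and column $s'$; $R(s,a)=\mathbb E[r(s,a,s')|s,a]$; $D$ is the diagonal matrix with entries $d(s,a)$. For a deterministic policy $\pi$, $\Pi^\pi\in\mathbb R^{|\mathcal S|\times|\mathcal S||\mathcal A|}$ has $s$-th row $e_{\pi(s)}^T\otimes e_s^T$. The greedy policy is $\pi_Q(s)=\arg\max_{a}Q(s,a)$ (some fixed maximizer), and $\Pi_Q:=\Pi^{\pi_Q}$, so $(\Pi_QQ)(s)=\max_aQ(s,a)$. Q-learning with constant step-size $\alpha$: $Q_{k+1}(s_k,a_k)=Q_k(s_k,a_k)+\alpha\{r_k+\gamma\max_uQ_k(s_k',u)-Q_k(s_k,a_k)\}$, other entries unchanged. Equivalently $Q_{k+1}=Q_k+\alpha\{DR+\gamma DP\Pi_{Q_k}Q_k-DQ_k+w_k\}$, where $$w_k=(e_{a_k}\otimes e_{s_k})r_k+\gamma(e_{a_k}\otimes e_{s_k})e_{s_k'}^T\Pi_{Q_k}Q_k-(e_{a_k}\otimes e_{s_k})(e_{a_k}\otimes e_{s_k})^TQ_k-(DR+\gamma DP\Pi_{Q_k}Q_k-DQ_k).$$ For $Q\in\mathbb R^{|\mathcal S||\mathcal A|}$, $A_Q:=I+\alpha(\gamma DP\Pi_Q-D)$. Standing assumptions: $d(s,a)>0$ for all $(s,a)$; constant $\alpha\in(0,1)$;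 $|r(s,a,s')|\le1$; $\|Q_0\|_\infty\le1$. *)

theory Defs
  imports "HOL-Probability.Probability"
begin

text \<open>
  States and actions are finite types \<open>'s\<close>, \<open>'a\<close>. The transition law is a kernel
  \<open>P s a\<close>, the state distribution \<open>p\<close> and the behavior policy \<open>b\<close> are likewise given as
  probability mass functions. A function on state-action pairs is a vector indexed by
  pairs (action, state), the index order of \<open>e\<^sub>a \<otimes> e\<^sub>s\<close>.
\<close>

type_synonym ('s, 'a) kernel = "'s \<Rightarrow> 'a \<Rightarrow> 's pmf"
type_synonym ('s, 'a) reward = "'s \<Rightarrow> 'a \<Rightarrow> 's \<Rightarrow> real"
type_synonym ('s, 'a) qvec = "real ^ ('a \<times> 's)"

primrec chain_pmf :: "('x \<Rightarrow> 'x pmf) \<Rightarrow> nat \<Rightarrow> 'x \<Rightarrow> 'x pmf" where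
  "chain_pmf K 0 x = return_pmf x"
| "chain_pmf K (Suc n) x = bind_pmf (K x) (chain_pmf K n)"

definition irreducible_chain :: "('x \<Rightarrow> 'x pmf) \<Rightarrow> bool" where
  "irreducible_chain K \<longleftrightarrow> (\<forall>x y. \<exists>n. pmf (chain_pmf K n x) y > 0)"

definition aperiodic_chain :: "('x \<Rightarrow> 'x pmf) \<Rightarrow> bool" where
  "aperiodic_chain K \<longleftrightarrow> (\<forall>x. Gcd {n. n > 0 \<and> pmf (chain_pmf K n x) x > 0} = 1)"

definition ergodic_mdp :: "('s, 'a) kernel \<Rightarrow> bool" where
  "ergodic_mdp P \<longleftrightarrow>
     (\<forall>\<pi> :: 's \<Rightarrow> 'a. irreducible_chain (\<lambda>s. P s (\<pi> s)) \<and> aperiodic_chain (\<lambda>s. P s (\<pi> s)))"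

subsection \<open>The optimal Q-function\<close>

definition mean_reward :: "('s, 'a) kernel \<Rightarrow> ('s, 'a) reward \<Rightarrow> 's \<Rightarrow> 'a \<Rightarrow> real" where
  "mean_reward P r s a = measure_pmf.expectation (P s a) (r s a)"

definition policy_kernel :: "('s, 'a) kernel \<Rightarrow> ('s \<Rightarrow> 'a) \<Rightarrow> 's \<times> 'a \<Rightarrow> ('s \<times> 'a) pmf" where
  "policy_kernel P \<pi> = (\<lambda>(s, a). map_pmf (\<lambda>s'. (s', \<pi> s')) (P s a))"

text \<open>
  The expected discounted return of starting with \<open>(s, a)\<close> and following the deterministic
  policy \<open>\<pi>\<close> afterwards; as the rewards are bounded, the expectation is taken inside the
  discounted sum.
\<close>

definition policy_Q ::
    "('s, 'a) kernel \<Rightarrow> ('s, 'a) reward \<Rightarrow> real \<Rightarrow> ('s \<Rightarrow> 'a) \<Rightarrow> 's \<Rightarrow> 'a \<Rightarrow> real" where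
  "policy_Q P r \<gamma> \<pi> s a =
     (\<Sum>k. \<gamma> ^ k * measure_pmf.expectation (chain_pmf (policy_kernel P \<pi>) k (s, a))
                     (\<lambda>(t, u). mean_reward P r t u))"

definition optimal_Q ::
    "('s::finite, 'a::finite) kernel \<Rightarrow> ('s, 'a) reward \<Rightarrow> real \<Rightarrow> ('s, 'a) qvec" where
  "optimal_Q P r \<gamma> = (\<chi> i. MAX \<pi>. policy_Q P r \<gamma> \<pi> (snd i) (fst i))"

lemma expectation_pmf_finite:
  fixes q :: "'x::finite pmf" and f :: "'x \<Rightarrow> real"
  shows "measure_pmf.expectation q f = (\<Sum>x\<in>UNIV. pmf q x * f x)"
  by (subst integral_measure_pmf[of UNIV]) auto

lemma sum_pmf_finite: "(\<Sum>x\<in>UNIV. pmf (q :: 'x::finite pmf) x) = 1"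
  by (rule sum_pmf_eq_1) auto

lemma expectation_chain_Suc:
  fixes f :: "'x::finite \<Rightarrow> real"
  shows "measure_pmf.expectation (chain_pmf K (Suc n) x) f =
    measure_pmf.expectation (K x) (\<lambda>y. measure_pmf.expectation (chain_pmf K n y) f)"
proof -
  have "(\<Sum>z\<in>UNIV. pmf (chain_pmf K (Suc n) x) z * f z) =
        (\<Sum>z\<in>UNIV. \<Sum>y\<in>UNIV. pmf (K x) y * pmf (chain_pmf K n y) z * f z)"
    by (simp add: pmf_bind expectation_pmf_finite sum_distrib_right)
  also have "\<dots> = (\<Sum>y\<in>UNIV. \<Sum>z\<in>UNIV. pmf (K x) y * pmf (chain_pmf K n y) z * f z)"
    by (rule sum.swap)
  finally show ?thesis
    by (simp only: expectation_pmf_finite sum_distrib_left mult.assoc)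
qed

lemma policy_Q_step:
  fixes P :: "('s::finite, 'a::finite) kernel"
  assumes "0 \<le> \<gamma>" "\<gamma> < 1"
  shows "policy_Q P r \<gamma> \<pi> s a =
    mean_reward P r s a + \<gamma> * (\<Sum>s'\<in>UNIV. pmf (P s a) s' * policy_Q P r \<gamma> \<pi> s' (\<pi> s'))"
proof -
  define f where "f = (\<lambda>(t, u). mean_reward P r t u)"
  define E where "E k x = measure_pmf.expectation (chain_pmf (policy_kernel P \<pi>) k x) f" for k x
  define B where "B = (\<Sum>x\<in>UNIV. \<bar>f x\<bar>)"
  have fB: "\<bar>f x\<bar> \<le> B" for x
    unfolding B_def by (rule member_le_sum) auto
  have EB: "\<bar>E k x\<bar> \<le> B" for k x
  proof -
    have "\<bar>E k x\<bar> \<le> (\<Sum>y\<in>UNIV. \<bar>pmf (chain_pmf (policy_kernel P \<pi>) k x) y * f y\<bar>)"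
      unfolding E_def expectation_pmf_finite by (rule sum_abs)
    also have "\<dots> \<le> (\<Sum>y\<in>UNIV. pmf (chain_pmf (policy_kernel P \<pi>) k x) y * B)"
      by (intro sum_mono) (auto simp: abs_mult intro!: mult_left_mono fB)
    also have "\<dots> = B"
      by (simp add: sum_distrib_right[symmetric] sum_pmf_finite)
    finally show ?thesis .
  qed
  have summ: "summable (\<lambda>k. \<gamma> ^ k * E k x)" for x
  proof (rule summable_comparison_test)
    have "norm (\<gamma> ^ k * E k x) \<le> B * \<gamma> ^ k" for k
      using mult_left_mono[OF EB[of k x], of "\<gamma> ^ k"] assms(1)
      by (simp add: abs_mult mult.commute)
    then show "\<exists>N. \<forall>k\<ge>N. norm (\<gamma> ^ k * E k x) \<le> B * \<gamma> ^ k" by blast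
    show "summable (\<lambda>k. B * \<gamma> ^ k)"
      using assms by (intro summable_mult summable_geometric) auto
  qed
  have V: "policy_Q P r \<gamma> \<pi> t u = (\<Sum>k. \<gamma> ^ k * E k (t, u))" for t u
    by (simp add: policy_Q_def E_def f_def)
  have E0: "E 0 (s, a) = mean_reward P r s a"
    by (simp add: E_def f_def)
  have ES: "E (Suc k) (s, a) = (\<Sum>s'\<in>UNIV. pmf (P s a) s' * E k (s', \<pi> s'))" for k
  proof -
    have "E (Suc k) (s, a) = measure_pmf.expectation (policy_kernel P \<pi> (s, a)) (E k)"
      unfolding E_def expectation_chain_Suc ..
    then show ?thesis
      by (simp add: policy_kernel_def expectation_pmf_finite[of "P s a"])
  qed
  have "policy_Q P r \<gamma> \<pi> s a = E 0 (s, a) + (\<Sum>k. \<gamma> ^ Suc k * E (Suc k) (s, a))"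
    using suminf_split_head[OF summ, of "(s, a)"] by (simp add: V)
  also have "(\<lambda>k. \<gamma> ^ Suc k * E (Suc k) (s, a)) =
      (\<lambda>k. \<Sum>s'\<in>UNIV. \<gamma> * pmf (P s a) s' * (\<gamma> ^ k * E k (s', \<pi> s')))"
    by (simp add: ES sum_distrib_left mult_ac)
  also have "suminf \<dots> = (\<Sum>s'\<in>UNIV. \<Sum>k. \<gamma> * pmf (P s a) s' * (\<gamma> ^ k * E k (s', \<pi> s')))"
    by (intro suminf_sum summable_mult summ)
  also have "\<dots> = (\<Sum>s'\<in>UNIV. \<gamma> * pmf (P s a) s' * policy_Q P r \<gamma> \<pi> s' (\<pi> s'))"
    unfolding V by (intro sum.cong refl suminf_mult summ)
  also have "\<dots> = \<gamma> * (\<Sum>s'\<in>UNIV. pmf (P s a) s' * policy_Q P r \<gamma> \<pi> s' (\<pi> s'))"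
    by (simp only: sum_distrib_left mult.assoc)
  finally show ?thesis by (simp add: E0)
qed

lemma discounted_nonpos:
  fixes Z :: "'s::finite \<Rightarrow> 'a::finite \<Rightarrow> real"
  assumes "0 \<le> \<gamma>" "\<gamma> < 1"
    and Z: "\<And>s a. Z s a \<le> \<gamma> * (\<Sum>s'\<in>UNIV. pmf (P s a) s' * Z s' (\<pi> s'))"
  shows "Z s a \<le> 0"
proof -
  define m where "m = Max (range (\<lambda>(s, a). Z s a))"
  have le: "Z s a \<le> m" for s a
    unfolding m_def by (rule Max_ge) (auto intro: image_eqI[of _ _ "(s, a)"])
  have "m \<in> range (\<lambda>(s, a). Z s a)"
    unfolding m_def by (rule Max_in) auto
  then obtain t u where tu: "m = Z t u" by auto
  have "(\<Sum>s'\<in>UNIV. pmf (P t u) s' * Z s' (\<pi> s')) \<le> (\<Sum>s'\<in>UNIV. pmf (P t u) s' * m)"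
    by (intro sum_mono mult_left_mono le) auto
  also have "\<dots> = m"
    by (simp add: sum_distrib_right[symmetric] sum_pmf_finite)
  finally have "m \<le> \<gamma> * m"
    using Z[of t u] assms(1) tu by (meson mult_left_mono order_trans)
  then have "(1 - \<gamma>) * m \<le> 0" by (simp add: algebra_simps)
  then have "m \<le> 0" using assms(2) by (simp add: mult_le_0_iff)
  then show ?thesis using le[of s a] by simp
qed

theorem optimal_Q_bellman:
  fixes P :: "('s::finite, 'a::finite) kernel"
  assumes \<gamma>: "0 \<le> \<gamma>" "\<gamma> < 1"
  shows "optimal_Q P r \<gamma> $ (a, s) =
    (\<Sum>s'\<in>UNIV. pmf (P s a) s' * (r s a s' + \<gamma> * (MAX u. optimal_Q P r \<gamma> $ (u, s'))))"
proof -
  let ?V = "policy_Q P r \<gamma>"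
  define T where "T \<pi> q s a = mean_reward P r s a + \<gamma> * (\<Sum>s'\<in>UNIV. pmf (P s a) s' * q s' (\<pi> s'))"
    for \<pi> :: "'s \<Rightarrow> 'a" and q :: "'s \<Rightarrow> 'a \<Rightarrow> real" and s a
  have fix_T: "?V \<pi> s a = T \<pi> (?V \<pi>) s a" for \<pi> s a
    unfolding T_def by (rule policy_Q_step[OF \<gamma>])
  have T_diff: "T \<pi> q s a - T \<pi> q' s a =
      \<gamma> * (\<Sum>s'\<in>UNIV. pmf (P s a) s' * (q s' (\<pi> s') - q' s' (\<pi> s')))" for \<pi> q q' s a
    by (simp add: T_def right_diff_distrib sum_subtractf)
  have T_mono: "T \<pi> q s a \<le> T \<pi>' q s a" if "\<And>s. q s (\<pi> s) \<le> q s (\<pi>' s)" for \<pi> \<pi>' q s a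
    unfolding T_def using that \<gamma> by (intro add_left_mono mult_left_mono sum_mono) auto
  have upper: "?V \<pi> s a \<le> q s a" if "\<And>s a. T \<pi> q s a \<le> q s a" for \<pi> q s a
  proof -
    have "?V \<pi> s a - q s a \<le> \<gamma> * (\<Sum>s'\<in>UNIV. pmf (P s a) s' * (?V \<pi> s' (\<pi> s') - q s' (\<pi> s')))" for s a
      using that[of s a] fix_T[of \<pi> s a] T_diff[of \<pi> "?V \<pi>" s a q] by linarith
    from discounted_nonpos[OF \<gamma>, of "\<lambda>s a. ?V \<pi> s a - q s a", OF this] show ?thesis by simp
  qed
  have lower: "q s a \<le> ?V \<pi> s a" if "\<And>s a. q s a \<le> T \<pi> q s a" for \<pi> q s a
  proof -
    have "q s a - ?V \<pi> s a \<le> \<gamma> * (\<Sum>s'\<in>UNIV. pmf (P s a) s' * (q s' (\<pi> s') - ?V \<pi> s' (\<pi> s')))" for s a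
      using that[of s a] fix_T[of \<pi> s a] T_diff[of \<pi> q s a "?V \<pi>"] by linarith
    from discounted_nonpos[OF \<gamma>, of "\<lambda>s a. q s a - ?V \<pi> s a", OF this] show ?thesis by simp
  qed
  define tot where "tot \<pi> = (\<Sum>x\<in>UNIV. ?V \<pi> (fst x) (snd x))" for \<pi>
  have "Max (range tot) \<in> range tot" by (rule Max_in) auto
  then obtain \<pi> where "Max (range tot) = tot \<pi>" by (rule rangeE)
  then have best: "tot \<pi>' \<le> tot \<pi>" for \<pi>' by (metis Max_ge finite finite_imageI rangeI)
  have "\<exists>a. ?V \<pi> s a = (MAX u. ?V \<pi> s u)" for s
    using Max_in[of "range (?V \<pi> s)"] by (auto simp: image_iff)
  then obtain \<mu> where \<mu>: "\<And>s. ?V \<pi> s (\<mu> s) = (MAX u. ?V \<pi> s u)" by metis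
  have \<mu>_ge: "?V \<pi> s a \<le> ?V \<pi> s (\<mu> s)" for s a
    unfolding \<mu> by (rule Max_ge) auto
  have imp: "?V \<pi> s a \<le> T \<mu> (?V \<pi>) s a" for s a
    using fix_T[of \<pi> s a] T_mono[of "?V \<pi>" \<pi> \<mu> s a] \<mu>_ge by simp
  have le: "?V \<pi> s a \<le> ?V \<mu> s a" for s a
    by (rule lower) (rule imp)
  have "?V \<pi> s a = ?V \<mu> s a" for s a
  proof (rule ccontr)
    assume "?V \<pi> s a \<noteq> ?V \<mu> s a"
    then have "?V \<pi> s a < ?V \<mu> s a" using le[of s a] by simp
    then have "tot \<pi> < tot \<mu>"
      unfolding tot_def by (intro sum_strict_mono_ex1) (auto intro: le bexI[of _ "(s, a)"])
    then show False using best[of \<mu>] by simp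
  qed
  then have eq: "?V \<mu> = ?V \<pi>" by (intro ext) simp
  have fix_best: "?V \<pi> s a = T \<mu> (?V \<pi>) s a" for s a
    using fix_T[of \<mu> s a] unfolding eq .
  have all: "?V \<pi>' s a \<le> ?V \<pi> s a" for \<pi>' s a
  proof (rule upper)
    show "T \<pi>' (?V \<pi>) s a \<le> ?V \<pi> s a" for s a
      using T_mono[of "?V \<pi>" \<pi>' \<mu> s a] \<mu>_ge fix_best[of s a] by simp
  qed
  have opt: "optimal_Q P r \<gamma> $ (u, t) = ?V \<pi> t u" for t u
    unfolding optimal_Q_def by (auto intro!: Max_eqI all)
  show ?thesis
    unfolding opt \<mu>[symmetric]
    by (subst fix_best)
      (simp add: T_def mean_reward_def expectation_pmf_finite distrib_left sum.distrib
        sum_distrib_left mult_ac)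
qed

subsection \<open>Vector notation\<close>

definition kron :: "real ^ 'm \<Rightarrow> real ^ 'n \<Rightarrow> real ^ ('m::finite \<times> 'n::finite)" where
  "kron x y = (\<chi> i. x $ fst i * y $ snd i)"

definition e_sa :: "'s \<Rightarrow> 'a \<Rightarrow> ('s::finite, 'a::finite) qvec" where
  "e_sa s a = kron (axis a 1) (axis s 1)"

definition P_mat :: "('s::finite, 'a::finite) kernel \<Rightarrow> real ^ 's ^ ('a \<times> 's)" where
  "P_mat P = (\<chi> i s'. pmf (P (snd i) (fst i)) s')"

definition R_vec :: "('s::finite, 'a::finite) kernel \<Rightarrow> ('s, 'a) reward \<Rightarrow> ('s, 'a) qvec" where
  "R_vec P r = (\<chi> i. mean_reward P r (snd i) (fst i))"

definition samp_prob :: "'s pmf \<Rightarrow> ('s \<Rightarrow> 'a pmf) \<Rightarrow> 's \<Rightarrow> 'a \<Rightarrow> real" where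
  "samp_prob p b s a = pmf p s * pmf (b s) a"

definition D_mat ::
    "'s pmf \<Rightarrow> ('s \<Rightarrow> 'a pmf) \<Rightarrow> real ^ ('a \<times> 's) ^ ('a::finite \<times> 's::finite)" where
  "D_mat p b = (\<chi> i j. if i = j then samp_prob p b (snd i) (fst i) else 0)"

definition Pi_mat :: "('s \<Rightarrow> 'a) \<Rightarrow> real ^ ('a::finite \<times> 's::finite) ^ 's" where
  "Pi_mat \<pi> = (\<chi> s. e_sa s (\<pi> s))"

text \<open>\<open>g\<close> fixes, for every \<open>Q\<close>, one maximizing action per state.\<close>

definition greedy_selector :: "(('s::finite, 'a::finite) qvec \<Rightarrow> 's \<Rightarrow> 'a) \<Rightarrow> bool" where
  "greedy_selector g \<longleftrightarrow> (\<forall>Q s. is_arg_max (\<lambda>a. Q $ (a, s)) (\<lambda>_. True) (g Q s))"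

definition A_mat ::
    "('s, 'a) kernel \<Rightarrow> real \<Rightarrow> 's pmf \<Rightarrow> ('s \<Rightarrow> 'a pmf) \<Rightarrow> (('s, 'a) qvec \<Rightarrow> 's \<Rightarrow> 'a) \<Rightarrow> real
     \<Rightarrow> ('s, 'a) qvec \<Rightarrow> real ^ ('a \<times> 's) ^ ('a::finite \<times> 's::finite)" where
  "A_mat P \<gamma> p b g \<alpha> Q =
     mat 1 + \<alpha> *\<^sub>R (\<gamma> *\<^sub>R (D_mat p b ** P_mat P ** Pi_mat (g Q)) - D_mat p b)"

subsection \<open>The Q-learning iteration\<close>

definition sample_pmf ::
    "('s, 'a) kernel \<Rightarrow> 's pmf \<Rightarrow> ('s \<Rightarrow> 'a pmf) \<Rightarrow> ('s \<times> 'a \<times> 's) pmf" where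
  "sample_pmf P p b =
     bind_pmf p (\<lambda>s. bind_pmf (b s) (\<lambda>a. map_pmf (\<lambda>s'. (s, a, s')) (P s a)))"

definition iid_samples ::
    "('s, 'a) kernel \<Rightarrow> 's pmf \<Rightarrow> ('s \<Rightarrow> 'a pmf) \<Rightarrow> 'w measure
     \<Rightarrow> (nat \<Rightarrow> 'w \<Rightarrow> 's) \<Rightarrow> (nat \<Rightarrow> 'w \<Rightarrow> 'a) \<Rightarrow> (nat \<Rightarrow> 'w \<Rightarrow> 's) \<Rightarrow> bool" where
  "iid_samples P p b M S A S' \<longleftrightarrow>
     prob_space M \<and>
     prob_space.indep_vars M (\<lambda>_. count_space UNIV) (\<lambda>k \<omega>. (S k \<omega>, A k \<omega>, S' k \<omega>)) UNIV \<and>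
     (\<forall>k. distr M (count_space UNIV) (\<lambda>\<omega>. (S k \<omega>, A k \<omega>, S' k \<omega>)) = measure_pmf (sample_pmf P p b))"

definition q_update ::
    "('s, 'a) reward \<Rightarrow> real \<Rightarrow> real \<Rightarrow> ('s::finite, 'a::finite) qvec \<Rightarrow> 's \<Rightarrow> 'a \<Rightarrow> 's
     \<Rightarrow> ('s, 'a) qvec" where
  "q_update r \<gamma> \<alpha> Q s a s' =
     (\<chi> i. if i = (a, s)
           then Q $ (a, s) + \<alpha> * (r s a s' + \<gamma> * (MAX u. Q $ (u, s')) - Q $ (a, s))
           else Q $ i)"

definition noise ::
    "('s, 'a) kernel \<Rightarrow> ('s, 'a) reward \<Rightarrow> real \<Rightarrow> 's pmf \<Rightarrow> ('s \<Rightarrow> 'a pmf)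
     \<Rightarrow> (('s, 'a) qvec \<Rightarrow> 's \<Rightarrow> 'a) \<Rightarrow> ('s::finite, 'a::finite) qvec \<Rightarrow> 's \<Rightarrow> 'a \<Rightarrow> 's
     \<Rightarrow> ('s, 'a) qvec" where
  "noise P r \<gamma> p b g Q s a s' =
     r s a s' *\<^sub>R e_sa s a
     + (\<gamma> * (axis s' 1 \<bullet> (Pi_mat (g Q) *v Q))) *\<^sub>R e_sa s a
     - (e_sa s a \<bullet> Q) *\<^sub>R e_sa s a
     - (D_mat p b *v R_vec P r + \<gamma> *\<^sub>R ((D_mat p b ** P_mat P ** Pi_mat (g Q)) *v Q)
        - D_mat p b *v Q)"

lemma greedy_selector_Max:
  assumes "greedy_selector g"
  shows "Q $ (g Q s, s) = (MAX u. Q $ (u, s))"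
  using assms by (intro Max_eqI[symmetric]) (auto simp: greedy_selector_def is_arg_max_linorder)

lemma e_sa_eq_axis: "e_sa s a = axis (a, s) 1"
  by (auto simp: e_sa_def kron_def axis_def vec_eq_iff)

lemma Pi_mat_mult_nth: "(Pi_mat \<pi> *v Q) $ s = Q $ (\<pi> s, s)"
  by (simp add: Pi_mat_def e_sa_eq_axis matrix_vector_mul_component inner_axis')

lemma q_update_eq_noise:
  assumes "greedy_selector g"
  shows "q_update r \<gamma> \<alpha> Q s a s' =
    Q + \<alpha> *\<^sub>R (D_mat p b *v R_vec P r + \<gamma> *\<^sub>R ((D_mat p b ** P_mat P ** Pi_mat (g Q)) *v Q)
               - D_mat p b *v Q + noise P r \<gamma> p b g Q s a s')"
proof -
  have "axis s' 1 \<bullet> (Pi_mat (g Q) *v Q) = (MAX u. Q $ (u, s'))"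
    by (simp add: inner_axis' Pi_mat_mult_nth greedy_selector_Max[OF assms])
  moreover have "e_sa s a \<bullet> Q = Q $ (a, s)"
    by (simp add: e_sa_eq_axis inner_axis')
  moreover have "e_sa s a $ i = (if i = (a, s) then 1 else 0)" for i
    by (auto simp: e_sa_eq_axis axis_def)
  ultimately show ?thesis
    by (auto simp: vec_eq_iff q_update_def noise_def algebra_simps)
qed

end

theory Submission
  imports Defs
begin

text \<open>
  Two order facts drive the comparison. First, the matrix \<open>A_mat\<close> has nonnegative entries:
  its diagonal part is \<open>1 - \<alpha> d(s, a)\<close> with \<open>\<alpha> \<le> 1\<close> and \<open>d(s, a) \<le> 1\<close>, and its remaining part
  is a nonnegative multiple of transition probabilities. Hence it preserves the elementwise
  order (\<open>A_mat_mult_mono\<close>). Second, the Q-learning step, centred at the optimal Q-function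
  \<open>Q\<^sup>*\<close>, dominates one step of the linear system driven by the same noise
  (\<open>q_update_ge_linear_step\<close>). Indeed the Bellman equation removes the affine part
  \<open>D R\<close>, and the difference of the two steps is then
  \<open>\<alpha> \<gamma> D P (\<Pi>\<^sub>Q Q - \<Pi>\<^sub>Q\<^sub>* Q)\<close>, which is nonnegative because the greedy
  policy of \<open>Q\<close> selects the maximum of \<open>Q\<close> while the greedy policy of \<open>Q\<^sup>*\<close> only selects
  some entry of it. Together,
  \<open>Q\<^sub>k\<^sub>+\<^sub>1 - Q\<^sup>* \<ge> A (Q\<^sub>k - Q\<^sup>*) + \<alpha> w\<^sub>k \<ge> A (Q\<^sup>L\<^sub>k - Q\<^sup>*) + \<alpha> w\<^sub>k\<close>,
  and the claim follows by induction on \<open>k\<close>, separately for every sample path.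
\<close>

lemma samp_prob_nonneg: "0 \<le> samp_prob p b s a"
  by (simp add: samp_prob_def)

lemma samp_prob_le_1: "samp_prob p b s a \<le> 1"
  by (simp add: samp_prob_def mult_le_one pmf_le_1)

lemma D_mat_mult_nth: "(D_mat p b *v x) $ (a, s) = samp_prob p b s a * x $ (a, s)"
proof -
  have "(D_mat p b *v x) $ (a, s) =
      (\<Sum>j\<in>UNIV. if j = (a, s) then samp_prob p b s a * x $ j else 0)"
    unfolding D_mat_def matrix_vector_mult_def vec_lambda_beta by (intro sum.cong) auto
  then show ?thesis by simp
qed

lemma P_mat_mult_nth: "(P_mat P *v v) $ (a, s) = (\<Sum>s'\<in>UNIV. pmf (P s a) s' * v $ s')"
  by (simp add: P_mat_def matrix_vector_mult_def)

lemma DPPi_mult_nth: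
  "((D_mat p b ** P_mat P ** Pi_mat \<pi>) *v x) $ (a, s) =
     samp_prob p b s a * (\<Sum>s'\<in>UNIV. pmf (P s a) s' * x $ (\<pi> s', s'))"
  by (simp add: matrix_vector_mul_assoc[symmetric] D_mat_mult_nth P_mat_mult_nth Pi_mat_mult_nth)

lemma A_mat_mult_eq:
  "A_mat P \<gamma> p b g \<alpha> Q *v x =
     x + \<alpha> *\<^sub>R (\<gamma> *\<^sub>R ((D_mat p b ** P_mat P ** Pi_mat (g Q)) *v x) - D_mat p b *v x)"
  by (simp add: A_mat_def matrix_vector_mult_add_rdistrib matrix_vector_mult_diff_rdistrib
      scaleR_matrix_vector_assoc[symmetric])

lemma A_mat_mult_nth:
  "(A_mat P \<gamma> p b g \<alpha> Q *v x) $ (a, s) =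
     (1 - \<alpha> * samp_prob p b s a) * x $ (a, s)
     + \<alpha> * \<gamma> * samp_prob p b s a * (\<Sum>s'\<in>UNIV. pmf (P s a) s' * x $ (g Q s', s'))"
  by (simp add: A_mat_mult_eq D_mat_mult_nth DPPi_mult_nth algebra_simps)

text \<open>
  The step-size bound \<open>\<alpha> \<le> 1\<close> keeps the diagonal weight \<open>1 - \<alpha> d(s, a)\<close> of the old value
  nonnegative, so that every entry of \<open>A_mat\<close> is nonnegative.
\<close>

lemma A_mat_mult_mono:
  assumes "0 \<le> \<gamma>" "0 \<le> \<alpha>" "\<alpha> \<le> 1" and "x \<le> y"
  shows "A_mat P \<gamma> p b g \<alpha> Q *v x \<le> A_mat P \<gamma> p b g \<alpha> Q *v y"
proof -
  have xy: "x $ i \<le> y $ i" for i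
    using assms(4) unfolding less_eq_vec_def by blast
  have "(A_mat P \<gamma> p b g \<alpha> Q *v x) $ (a, s) \<le> (A_mat P \<gamma> p b g \<alpha> Q *v y) $ (a, s)" for a s
  proof -
    have "0 \<le> 1 - \<alpha> * samp_prob p b s a"
      using assms by (simp add: mult_le_one samp_prob_nonneg samp_prob_le_1)
    then show ?thesis
      unfolding A_mat_mult_nth using assms
      by (intro add_mono mult_left_mono sum_mono xy) (auto simp: samp_prob_nonneg)
  qed
  then show ?thesis by (simp add: less_eq_vec_def)
qed

text \<open>
  Weighting the Bellman equation of each pair by its sampling probability says that the mean
  Q-learning drift vanishes at the optimal Q-function.
\<close>

lemma optimal_Q_drift_eq_0:
  fixes P :: "('s::finite, 'a::finite) kernel" and r :: "('s, 'a) reward"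
  assumes "0 \<le> \<gamma>" "\<gamma> < 1" and "greedy_selector g"
  defines "Qs \<equiv> optimal_Q P r \<gamma>"
  shows "D_mat p b *v R_vec P r + \<gamma> *\<^sub>R ((D_mat p b ** P_mat P ** Pi_mat (g Qs)) *v Qs)
    - D_mat p b *v Qs = 0"
proof -
  have "Qs $ (a, s) = R_vec P r $ (a, s)
      + \<gamma> * (\<Sum>s'\<in>UNIV. pmf (P s a) s' * Qs $ (g Qs s', s'))" for a s
    unfolding greedy_selector_Max[OF assms(3)]
    unfolding Qs_def optimal_Q_bellman[OF assms(1,2), of P r a s]
    by (simp add: R_vec_def mean_reward_def expectation_pmf_finite distrib_left sum.distrib
        sum_distrib_left mult_ac)
  then have "samp_prob p b s a * Qs $ (a, s) = samp_prob p b s a * (R_vec P r $ (a, s)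
      + \<gamma> * (\<Sum>s'\<in>UNIV. pmf (P s a) s' * Qs $ (g Qs s', s')))" for a s
    by (rule arg_cong)
  then show ?thesis
    by (simp add: vec_eq_iff D_mat_mult_nth DPPi_mult_nth algebra_simps)
qed

lemma DPPi_greedy_mono:
  assumes "greedy_selector g"
  shows "(D_mat p b ** P_mat P ** Pi_mat \<pi>) *v Q \<le> (D_mat p b ** P_mat P ** Pi_mat (g Q)) *v Q"
proof -
  have "Q $ (\<pi> s, s) \<le> Q $ (g Q s, s)" for s
    unfolding greedy_selector_Max[OF assms] by (rule Max_ge) auto
  then have "((D_mat p b ** P_mat P ** Pi_mat \<pi>) *v Q) $ (a, s)
      \<le> ((D_mat p b ** P_mat P ** Pi_mat (g Q)) *v Q) $ (a, s)" for a s
    unfolding DPPi_mult_nth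
    by (intro mult_left_mono sum_mono) (auto simp: samp_prob_nonneg)
  then show ?thesis by (simp add: less_eq_vec_def)
qed

text \<open>
  The noise is evaluated at \<open>Q\<close> on both sides and cancels; subtracting the vanishing drift at the
  optimal Q-function leaves a difference of two maximization terms at the same \<open>Q\<close>.
\<close>

lemma q_update_ge_linear_step:
  fixes P :: "('s::finite, 'a::finite) kernel" and r :: "('s, 'a) reward"
  assumes "0 \<le> \<gamma>" "\<gamma> < 1" "0 \<le> \<alpha>" and "greedy_selector g"
  defines "Qs \<equiv> optimal_Q P r \<gamma>"
  shows "A_mat P \<gamma> p b g \<alpha> Qs *v (Q - Qs) + \<alpha> *\<^sub>R noise P r \<gamma> p b g Q s a s'
    \<le> q_update r \<gamma> \<alpha> Q s a s' - Qs"
proof -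
  let ?D = "D_mat p b" and ?R = "R_vec P r"
  define H where "H \<pi> = ?D ** P_mat P ** Pi_mat \<pi>" for \<pi> :: "'s \<Rightarrow> 'a"
  have drift: "?D *v ?R + \<gamma> *\<^sub>R (H (g Qs) *v Qs) - ?D *v Qs = 0"
    unfolding H_def Qs_def by (rule optimal_Q_drift_eq_0[OF assms(1,2,4)])
  have "q_update r \<gamma> \<alpha> Q s a s' - Qs
      - (A_mat P \<gamma> p b g \<alpha> Qs *v (Q - Qs) + \<alpha> *\<^sub>R noise P r \<gamma> p b g Q s a s')
    = (\<alpha> * \<gamma>) *\<^sub>R (H (g Q) *v Q - H (g Qs) *v Q)
      + \<alpha> *\<^sub>R (?D *v ?R + \<gamma> *\<^sub>R (H (g Qs) *v Qs) - ?D *v Qs)"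
    unfolding q_update_eq_noise[OF assms(4), of r \<gamma> \<alpha> Q s a s' p b P] A_mat_mult_eq
      H_def[symmetric]
    by (simp add: matrix_vector_mult_diff_distrib algebra_simps)
  also have "\<dots> = (\<alpha> * \<gamma>) *\<^sub>R (H (g Q) *v Q - H (g Qs) *v Q)"
    unfolding drift by simp
  finally have eq: "q_update r \<gamma> \<alpha> Q s a s' - Qs
      - (A_mat P \<gamma> p b g \<alpha> Qs *v (Q - Qs) + \<alpha> *\<^sub>R noise P r \<gamma> p b g Q s a s')
    = (\<alpha> * \<gamma>) *\<^sub>R (H (g Q) *v Q - H (g Qs) *v Q)" .
  have "(H (g Qs) *v Q) $ i \<le> (H (g Q) *v Q) $ i" for i
    using DPPi_greedy_mono[OF assms(4), of p b P "g Qs" Q]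
    unfolding H_def less_eq_vec_def by blast
  then have "0 \<le> ((\<alpha> * \<gamma>) *\<^sub>R (H (g Q) *v Q - H (g Qs) *v Q)) $ i" for i
    using assms(1,3) by simp
  then show ?thesis
    unfolding eq[symmetric] by (simp add: less_eq_vec_def)
qed

theorem proposition2:
  fixes P :: "('s::finite, 'a::finite) kernel"
    and r :: "('s, 'a) reward"
    and \<gamma> \<alpha> :: real
    and p :: "'s pmf"
    and b :: "'s \<Rightarrow> 'a pmf"
    and g :: "('s, 'a) qvec \<Rightarrow> 's \<Rightarrow> 'a"
    and M :: "'w measure"
    and S S' :: "nat \<Rightarrow> 'w \<Rightarrow> 's"
    and A :: "nat \<Rightarrow> 'w \<Rightarrow> 'a"
    and Q0 QL0 Qstar :: "('s, 'a) qvec"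
    and Q QL :: "nat \<Rightarrow> 'w \<Rightarrow> ('s, 'a) qvec"
  assumes "0 \<le> \<gamma>" "\<gamma> < 1"
    and "ergodic_mdp P"
    and "\<And>s a s'. \<bar>r s a s'\<bar> \<le> 1"
    and "\<And>s a. samp_prob p b s a > 0"
    and "0 < \<alpha>" "\<alpha> < 1"
    and "greedy_selector g"
    and "iid_samples P p b M S A S'"
    and "infnorm Q0 \<le> 1"
    and "\<And>\<omega>. \<omega> \<in> space M \<Longrightarrow> Q 0 \<omega> = Q0"
    and "\<And>k \<omega>. \<omega> \<in> space M \<Longrightarrow>
           Q (Suc k) \<omega> = q_update r \<gamma> \<alpha> (Q k \<omega>) (S k \<omega>) (A k \<omega>) (S' k \<omega>)"
    and "Qstar = optimal_Q P r \<gamma>"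
    and "\<And>\<omega>. \<omega> \<in> space M \<Longrightarrow> QL 0 \<omega> = QL0"
    and "\<And>k \<omega>. \<omega> \<in> space M \<Longrightarrow>
           QL (Suc k) \<omega> - Qstar =
             A_mat P \<gamma> p b g \<alpha> Qstar *v (QL k \<omega> - Qstar)
             + \<alpha> *\<^sub>R noise P r \<gamma> p b g (Q k \<omega>) (S k \<omega>) (A k \<omega>) (S' k \<omega>)"
    and "QL0 - Qstar \<le> Q0 - Qstar"
  shows "\<forall>k. \<forall>\<omega> \<in> space M. QL k \<omega> - Qstar \<le> Q k \<omega> - Qstar"
proof (intro allI ballI)
  fix k \<omega>
  assume \<omega>: "\<omega> \<in> space M"
  let ?A = "A_mat P \<gamma> p b g \<alpha> Qstar"
  show "QL k \<omega> - Qstar \<le> Q k \<omega> - Qstar"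
  proof (induction k)
    case 0
    then show ?case
      using assms(11)[OF \<omega>] assms(14)[OF \<omega>] assms(16) by simp
  next
    case (Suc k)
    let ?w = "noise P r \<gamma> p b g (Q k \<omega>) (S k \<omega>) (A k \<omega>) (S' k \<omega>)"
    have "?A *v (QL k \<omega> - Qstar) \<le> ?A *v (Q k \<omega> - Qstar)"
      using assms(1,6,7) Suc.IH by (intro A_mat_mult_mono) auto
    then have "QL (Suc k) \<omega> - Qstar \<le> ?A *v (Q k \<omega> - Qstar) + \<alpha> *\<^sub>R ?w"
      unfolding assms(15)[OF \<omega>] by (simp add: less_eq_vec_def)
    also have "\<dots> \<le> Q (Suc k) \<omega> - Qstar"
      unfolding assms(12)[OF \<omega>] assms(13)
      using assms(1,2,6,8) by (intro q_update_ge_linear_step) auto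
    finally show ?case .
  qed
qed

end
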